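(* Let $a_1,a_2,b_1,b_2$ be integers with $a_1,a_2$ positive. Suppose that either (A) $-a_1 \leq b_1 \leq 0$ and $-a_2 \leq b_2 \leq 0$, or (B) $b_1 \geq 0$ and $b_2 \geq 0$. Then every $(a_1+a_2,\, b_1+b_2)$-sparse graph $G$ admits a partition $E(G) = E(G_1) \cup E(G_2)$ (with $E(G_1)\cap E(G_2)=\emptyset$, $G_1,G_2$ subgraphs of $G$) such that $G_1$ is $(a_1,b_1)$-sparse and $G_2$ is $(a_2,b_2)$-sparse.
   Context: All graphs are finite and simple. For a graph $H$, $v(H)$ and $e(H)$ denote its numbers of vertices and edges. For $a \in \mathbb{R}_{>0}$ and $b \in \mathbb{R}$, a graph $G$ is $(a,b)$-sparse if every nonempty subgraph $H$ of $G$ satisfies $e(H) \leq a\, v(H) + b$. *)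

theory Defs
  imports Complex_Main
begin

text \<open>An undirected edge is the two-element set of its end vertices.\<close>

record 'v graph =
  verts :: "'v set"
  edges :: "'v set set"

definition simple_graph :: "'v graph \<Rightarrow> bool" where
  "simple_graph G \<longleftrightarrow> finite (verts G) \<and> (\<forall>e\<in>edges G. e \<subseteq> verts G \<and> card e = 2)"

definition subgraph :: "'v graph \<Rightarrow> 'v graph \<Rightarrow> bool" where
  "subgraph H G \<longleftrightarrow> simple_graph H \<and> verts H \<subseteq> verts G \<and> edges H \<subseteq> edges G"

text \<open>A nonempty subgraph is one with at least one vertex; it may have no edges.\<close>

definition sparse :: "real \<Rightarrow> real \<Rightarrow> 'v graph \<Rightarrow> bool" where
  "sparse a b G \<longleftrightarrow>
     (\<forall>H. subgraph H G \<and> verts H \<noteq> {} \<longrightarrow>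
        real (card (edges H)) \<le> a * real (card (verts H)) + b)"

end

theory Submission
  imports Defs
begin

text \<open>
  The argument is Rado's proof of his transversal theorem, applied to a pair of submodular
  functions. If \<open>r1\<close> and \<open>r2\<close> are submodular, vanish on the empty set and satisfy
  \<open>|J| \<le> r1 J + r2 J\<close> for all sets \<open>J\<close> of edges, then the edges can be assigned one at a time to one
  of two classes so that the inequality, with \<open>J\<close> replaced on the right by its parts that
  are still admissible for either class, is preserved. In the end \<open>|J| \<le> ri J\<close>
  for each \<open>J\<close> inside class \<open>i\<close>.

  In case (B) take \<open>ri J = ai v(J) + bi\<close> for nonempty \<open>J\<close>. In case (A) take
  \<open>ri J = ai v(J) + bi c(J)\<close>, where \<open>c\<close> counts connected components. This equals
  \<open>(ai + bi) v(J) + (- bi) (v(J) - c(J))\<close>, a nonnegative combination of the submodular functions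
  \<open>v\<close> and \<open>v - c\<close> (the graphic matroid rank), and \<open>|J| \<le> r1 J + r2 J\<close> follows by summing
  the sparsity condition over the components of \<open>J\<close>.
\<close>

section \<open>Submodular functions\<close>

definition submodular_on :: "'e set \<Rightarrow> ('e set \<Rightarrow> int) \<Rightarrow> bool" where
  "submodular_on E r \<longleftrightarrow> (\<forall>A B. A \<subseteq> E \<longrightarrow> B \<subseteq> E \<longrightarrow> r (A \<union> B) + r (A \<inter> B) \<le> r A + r B)"

lemma submodular_onD:
  "submodular_on E r \<Longrightarrow> A \<subseteq> E \<Longrightarrow> B \<subseteq> E \<Longrightarrow> r (A \<union> B) + r (A \<inter> B) \<le> r A + r B"
  by (simp add: submodular_on_def)

lemma submodular_on_add:
  assumes "submodular_on E r" "submodular_on E s"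
  shows "submodular_on E (\<lambda>J. r J + s J)"
  unfolding submodular_on_def
proof (intro allI impI)
  fix A B assume "A \<subseteq> E" "B \<subseteq> E"
  then show "r (A \<union> B) + s (A \<union> B) + (r (A \<inter> B) + s (A \<inter> B)) \<le> r A + s A + (r B + s B)"
    using submodular_onD[OF assms(1), of A B] submodular_onD[OF assms(2), of A B] by linarith
qed

lemma submodular_on_scale:
  assumes "submodular_on E r" "0 \<le> (c::int)"
  shows "submodular_on E (\<lambda>J. c * r J)"
  unfolding submodular_on_def
proof (intro allI impI)
  fix A B assume "A \<subseteq> E" "B \<subseteq> E"
  then have "c * (r (A \<union> B) + r (A \<inter> B)) \<le> c * (r A + r B)"
    using submodular_onD[OF assms(1)] assms(2) by (intro mult_left_mono) auto
  then show "c * r (A \<union> B) + c * r (A \<inter> B) \<le> c * r A + c * r B"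
    by (simp add: distrib_left)
qed

text \<open>Adding the elements of \<open>B\<close> one at a time to \<open>A\<close> and to
  \<open>A \<inter> B\<close> and telescoping the gains compares
  \<open>r (A \<union> B) - r A\<close> with \<open>r B - r (A \<inter> B)\<close>. Submodularity
  can thus be checked one edge at a time.\<close>

lemma submodular_on_diminishing_returns:
  assumes "finite E"
    and step: "\<And>A B e. A \<subseteq> B \<Longrightarrow> B \<subseteq> E \<Longrightarrow> e \<in> E \<Longrightarrow> r (insert e B) - r B \<le> r (insert e A) - r A"
  shows "submodular_on E r"
  unfolding submodular_on_def
proof (intro allI impI)
  fix A B assume AB: "A \<subseteq> E" "B \<subseteq> E"
  have "X \<subseteq> E \<Longrightarrow> r (A \<union> X) - r A \<le> r ((A \<inter> B) \<union> X) - r (A \<inter> B)" if "finite X" for X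
    using that
  proof (induction X rule: finite_induct)
    case (insert e X)
    then have "r (insert e (A \<union> X)) - r (A \<union> X) \<le> r (insert e ((A \<inter> B) \<union> X)) - r ((A \<inter> B) \<union> X)"
      using AB by (intro step) auto
    with insert show ?case by simp
  qed simp
  moreover have "finite B" using AB assms(1) finite_subset by blast
  moreover have "(A \<inter> B) \<union> B = B" by blast
  ultimately show "r (A \<union> B) + r (A \<inter> B) \<le> r A + r B"
    using AB(2) by fastforce
qed

lemma submodular_cover_refine:
  assumes fin: "finite E" and sub: "submodular_on E r1" "submodular_on E r2"
    and cov: "E1 \<union> E2 = E"
    and bound: "\<And>J. J \<subseteq> E \<Longrightarrow> int (card J) \<le> r1 (J \<inter> E1) + r2 (J \<inter> E2)"
  shows "\<exists>F1 F2. F1 \<union> F2 = E \<and> F1 \<inter> F2 = {} \<and>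
           (\<forall>J. J \<subseteq> E \<longrightarrow> int (card J) \<le> r1 (J \<inter> F1) + r2 (J \<inter> F2))"
  using cov bound
proof (induction "card (E1 \<inter> E2)" arbitrary: E1 E2 rule: less_induct)
  case less
  show ?case
  proof (cases "E1 \<inter> E2 = {}")
    case True
    with less.prems show ?thesis by blast
  next
    case False
    then obtain e where e: "e \<in> E1" "e \<in> E2" by blast
    have finI: "finite (E1 \<inter> E2)" using less.prems(1) fin by auto
    have "card ((E1 - {e}) \<inter> E2) < card (E1 \<inter> E2)" "card (E1 \<inter> (E2 - {e})) < card (E1 \<inter> E2)"
      using e by (auto intro!: psubset_card_mono[OF finI])
    note IH = less.hyps[OF this(1)] less.hyps[OF this(2)]
    have cov': "(E1 - {e}) \<union> E2 = E" "E1 \<union> (E2 - {e}) = E"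
      using less.prems(1) e by auto
    show ?thesis
    proof (rule ccontr)
      assume no: "\<not> ?thesis"
      obtain J where J: "J \<subseteq> E" "int (card J) > r1 (J \<inter> (E1 - {e})) + r2 (J \<inter> E2)"
        using IH(1)[OF cov'(1)] no by (meson not_le)
      obtain K where K: "K \<subseteq> E" "int (card K) > r1 (K \<inter> E1) + r2 (K \<inter> (E2 - {e}))"
        using IH(2)[OF cov'(2)] no by (meson not_le)
      \<comment> \<open>A violating set must contain \<open>e\<close>, since otherwise deleting
        \<open>e\<close> leaves its traces on both sides unchanged.\<close>
      have eJ: "e \<in> J"
      proof (rule ccontr)
        assume "e \<notin> J"
        then have "J \<inter> (E1 - {e}) = J \<inter> E1" by blast
        with less.prems(2)[OF J(1)] J(2) show False by simp
      qed
      have eK: "e \<in> K"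
      proof (rule ccontr)
        assume "e \<notin> K"
        then have "K \<inter> (E2 - {e}) = K \<inter> E2" by blast
        with less.prems(2)[OF K(1)] K(2) show False by simp
      qed
      \<comment> \<open>The trace of \<open>J\<close> omits \<open>e\<close> while that of
        \<open>K\<close> contains it, so the union regains \<open>e\<close> and the intersection
        loses it. For \<open>r2\<close> the roles are exchanged.\<close>
      have "r1 ((J \<union> K) \<inter> E1) + r1 ((J \<inter> K - {e}) \<inter> E1) \<le> r1 (J \<inter> (E1 - {e})) + r1 (K \<inter> E1)"
      proof -
        have "J \<inter> (E1 - {e}) \<union> K \<inter> E1 = (J \<union> K) \<inter> E1"
          "J \<inter> (E1 - {e}) \<inter> (K \<inter> E1) = (J \<inter> K - {e}) \<inter> E1"
          using e eK by auto
        then show ?thesis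
          using submodular_onD[OF sub(1), of "J \<inter> (E1 - {e})" "K \<inter> E1"] J(1) K(1) by auto
      qed
      moreover have "r2 ((J \<union> K) \<inter> E2) + r2 ((J \<inter> K - {e}) \<inter> E2) \<le> r2 (J \<inter> E2) + r2 (K \<inter> (E2 - {e}))"
      proof -
        have "J \<inter> E2 \<union> K \<inter> (E2 - {e}) = (J \<union> K) \<inter> E2"
          "J \<inter> E2 \<inter> (K \<inter> (E2 - {e})) = (J \<inter> K - {e}) \<inter> E2"
          using e eJ by auto
        then show ?thesis
          using submodular_onD[OF sub(2), of "J \<inter> E2" "K \<inter> (E2 - {e})"] J(1) K(1) by auto
      qed
      moreover have "int (card (J \<union> K)) \<le> r1 ((J \<union> K) \<inter> E1) + r2 ((J \<union> K) \<inter> E2)"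
        "int (card (J \<inter> K - {e})) \<le> r1 ((J \<inter> K - {e}) \<inter> E1) + r2 ((J \<inter> K - {e}) \<inter> E2)"
        using J(1) K(1) by (auto intro!: less.prems(2))
      moreover have "card (J \<union> K) + card (J \<inter> K - {e}) + 1 = card J + card K"
      proof -
        have "finite J" "finite K" using J(1) K(1) fin finite_subset by auto
        then show ?thesis
          using card_Un_Int[of J K] card_Suc_Diff1[of "J \<inter> K" e] eJ eK by simp
      qed
      \<comment> \<open>Uncrossing loses only 1 in total cardinality, but two strict violations
        between integers amount to at least 2.\<close>
      ultimately show False using J(2) K(2) by linarith
    qed
  qed
qed

text \<open>The refinement starts from the cover in which both sides are all of \<open>E\<close>.
  For \<open>J\<close> inside one final class the trace on the other is empty, and its term vanishes
  by the normalisation at the empty set.\<close>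

lemma submodular_partition:
  assumes "finite E" "submodular_on E r1" "submodular_on E r2" "r1 {} = 0" "r2 {} = 0"
    and "\<And>J. J \<subseteq> E \<Longrightarrow> int (card J) \<le> r1 J + r2 J"
  shows "\<exists>F1 F2. F1 \<union> F2 = E \<and> F1 \<inter> F2 = {} \<and>
           (\<forall>J. J \<subseteq> F1 \<longrightarrow> int (card J) \<le> r1 J) \<and> (\<forall>J. J \<subseteq> F2 \<longrightarrow> int (card J) \<le> r2 J)"
proof -
  have "int (card J) \<le> r1 (J \<inter> E) + r2 (J \<inter> E)" if "J \<subseteq> E" for J
    using assms(6)[OF that] that by (simp add: Int_absorb2)
  then obtain F1 F2 where F: "F1 \<union> F2 = E" "F1 \<inter> F2 = {}"
    and b: "\<And>J. J \<subseteq> E \<Longrightarrow> int (card J) \<le> r1 (J \<inter> F1) + r2 (J \<inter> F2)"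
    using submodular_cover_refine[OF assms(1-3), of E E] by blast
  have "int (card J) \<le> r1 J" if "J \<subseteq> F1" for J
  proof -
    have "J \<inter> F1 = J" "J \<inter> F2 = {}" "J \<subseteq> E" using that F by auto
    then show ?thesis using b[of J] assms(5) by simp
  qed
  moreover have "int (card J) \<le> r2 J" if "J \<subseteq> F2" for J
  proof -
    have "J \<inter> F2 = J" "J \<inter> F1 = {}" "J \<subseteq> E" using that F by auto
    then show ?thesis using b[of J] assms(4) by simp
  qed
  ultimately show ?thesis using F by blast
qed

lemma card_Union_submodular:
  assumes "finite (\<Union>E)"
  shows "submodular_on E (\<lambda>J. int (card (\<Union>J)))"
  unfolding submodular_on_def
proof (intro allI impI)
  fix A B assume "A \<subseteq> E" "B \<subseteq> E"
  then have fin: "finite (\<Union>A)" "finite (\<Union>B)"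
    using assms by (meson Union_mono finite_subset)+
  have "card (\<Union>(A \<inter> B)) \<le> card (\<Union>A \<inter> \<Union>B)"
    using fin by (intro card_mono) auto
  then show "int (card (\<Union>(A \<union> B))) + int (card (\<Union>(A \<inter> B))) \<le> int (card (\<Union>A)) + int (card (\<Union>B))"
    using card_Un_Int[OF fin] by (simp add: Union_Un_distrib)
qed

section \<open>Components and the graphic rank\<close>

text \<open>The closure is reflexive on the whole vertex type, so a vertex that meets no edge forms
  a singleton class.\<close>

definition conn :: "'v set set \<Rightarrow> ('v \<times> 'v) set" where
  "conn J = {(u, v). {u, v} \<in> J}\<^sup>*"

text \<open>The parameter \<open>W\<close> lets different edge sets be compared on one common vertex
  set.\<close>

definition comps :: "'v set set \<Rightarrow> 'v set \<Rightarrow> 'v set set" where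
  "comps J W = (\<lambda>x. conn J `` {x}) ` W"

definition graphic_rank :: "'v set set \<Rightarrow> int" where
  "graphic_rank J = int (card (\<Union>J)) - int (card (comps J (\<Union>J)))"

section \<open>Connectivity as an equivalence relation\<close>

lemma conn_refl [simp]: "(x, x) \<in> conn J"
  by (simp add: conn_def)

lemma conn_trans: "(x, y) \<in> conn J \<Longrightarrow> (y, z) \<in> conn J \<Longrightarrow> (x, z) \<in> conn J"
  unfolding conn_def by (rule rtrancl_trans)

lemma conn_sym: "(x, y) \<in> conn J \<Longrightarrow> (y, x) \<in> conn J"
proof -
  have "sym {(u, v). {u, v} \<in> J}" by (auto simp: sym_def insert_commute)
  then show "(x, y) \<in> conn J \<Longrightarrow> (y, x) \<in> conn J"
    unfolding conn_def by (meson sym_rtrancl symD)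
qed

lemma conn_mono: "J \<subseteq> K \<Longrightarrow> conn J \<subseteq> conn K"
  unfolding conn_def by (rule rtrancl_mono) auto

lemma conn_edge: "{u, v} \<in> J \<Longrightarrow> (u, v) \<in> conn J"
  unfolding conn_def by auto

lemma conn_class_eq: "(x, y) \<in> conn J \<Longrightarrow> conn J `` {x} = conn J `` {y}"
  using conn_trans conn_sym by fast

lemma conn_outside: "x \<notin> \<Union>J \<Longrightarrow> conn J `` {x} = {x}"
proof -
  assume x: "x \<notin> \<Union>J"
  have "y = x" if "(x, y) \<in> conn J" for y
    using that unfolding conn_def by (rule converse_rtranclE) (use x in auto)
  then show ?thesis by auto
qed

lemma conn_within: "x \<in> \<Union>J \<Longrightarrow> conn J `` {x} \<subseteq> \<Union>J"
proof
  fix y assume x: "x \<in> \<Union>J" and "y \<in> conn J `` {x}"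
  then have "(y, x) \<in> conn J" by (auto intro: conn_sym)
  show "y \<in> \<Union>J"
  proof (rule ccontr)
    assume "y \<notin> \<Union>J"
    then have "x = y" using conn_outside[of y J] \<open>(y, x) \<in> conn J\<close> by blast
    with x \<open>y \<notin> \<Union>J\<close> show False by simp
  qed
qed

text \<open>A walk using the new edge runs inside \<open>J\<close> up to its first arrival at
  \<open>u\<close> or \<open>v\<close> and after its last departure from one of them. Allowing the
  same end in both places does no harm, by transitivity.\<close>

lemma conn_insert:
  "(x, y) \<in> conn (insert {u, v} J) \<longleftrightarrow>
     (x, y) \<in> conn J \<or> ((x, u) \<in> conn J \<or> (x, v) \<in> conn J) \<and> ((u, y) \<in> conn J \<or> (v, y) \<in> conn J)"
    (is "?L \<longleftrightarrow> ?R")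
proof
  assume ?L
  then show ?R
    unfolding conn_def[of "insert _ _"]
  proof (induction rule: rtrancl_induct)
    case (step y z)
    then have "{y, z} = {u, v} \<or> (y, z) \<in> conn J" by (auto intro: conn_edge)
    then show ?case using step.IH
      by (metis conn_refl conn_trans doubleton_eq_iff)
  qed simp
next
  have J: "conn J \<subseteq> conn (insert {u, v} J)" by (rule conn_mono) auto
  have uv: "(u, v) \<in> conn (insert {u, v} J)" by (rule conn_edge) simp
  assume ?R
  then show ?L using J uv conn_sym[OF uv] by (meson conn_trans subsetD)
qed

section \<open>Counting components\<close>

lemma finite_comps: "finite W \<Longrightarrow> finite (comps J W)"
  by (simp add: comps_def)

lemma comps_disjoint:
  assumes "C \<in> comps J W" "D \<in> comps J W" "C \<noteq> D"
  shows "C \<inter> D = {}"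
proof (rule ccontr)
  obtain x y where xy: "C = conn J `` {x}" "D = conn J `` {y}"
    using assms(1,2) by (auto simp: comps_def)
  assume "C \<inter> D \<noteq> {}"
  then obtain z where "(x, z) \<in> conn J" "(y, z) \<in> conn J" using xy by blast
  then have "C = D" using xy by (simp add: conn_class_eq)
  with assms(3) show False by simp
qed

text \<open>The new edge merges the classes of its ends if they differ, and changes no class
  otherwise. As both ends lie in \<open>W\<close>, both classes are counted.\<close>

lemma card_comps_insert:
  assumes "finite W" "u \<in> W" "v \<in> W"
  shows "int (card (comps (insert {u, v} J) W)) =
           int (card (comps J W)) - (if (u, v) \<in> conn J then 0 else 1)"
proof (cases "(u, v) \<in> conn J")
  case True
  have "(x, y) \<in> conn (insert {u, v} J) \<longleftrightarrow> (x, y) \<in> conn J" for x y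
    unfolding conn_insert using True conn_sym[OF True] by (meson conn_trans)
  then have "conn (insert {u, v} J) = conn J" by auto
  then show ?thesis using True by (simp add: comps_def)
next
  case False
  let ?U = "conn J `` {u}" and ?V = "conn J `` {v}" and ?K = "insert {u, v} J"
  have UV: "?U \<noteq> ?V" "?U \<in> comps J W" "?V \<in> comps J W"
    using False assms(2,3) conn_refl[of v J] unfolding comps_def by blast+
  have cls: "conn ?K `` {x} =
      (if conn J `` {x} = ?U \<or> conn J `` {x} = ?V then ?U \<union> ?V else conn J `` {x})" for x
  proof -
    have *: "conn J `` {x} = conn J `` {w} \<longleftrightarrow> (x, w) \<in> conn J" for w
      using conn_class_eq[of x w J] conn_refl[of w J] by blast
    show ?thesis
    proof (cases "(x, u) \<in> conn J \<or> (x, v) \<in> conn J")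
      case True
      have "(x, y) \<in> conn ?K \<longleftrightarrow> (u, y) \<in> conn J \<or> (v, y) \<in> conn J" for y
        unfolding conn_insert using True by (meson conn_sym conn_trans)
      then have "conn ?K `` {x} = ?U \<union> ?V" by blast
      then show ?thesis using True * by simp
    next
      case False
      then have "(x, y) \<in> conn ?K \<longleftrightarrow> (x, y) \<in> conn J" for y
        by (simp add: conn_insert)
      then have "conn ?K `` {x} = conn J `` {x}" by blast
      then show ?thesis using False * by simp
    qed
  qed
  have "comps ?K W = insert (?U \<union> ?V) (comps J W - {?U, ?V})"
  proof (rule set_eqI)
    fix C
    show "C \<in> comps ?K W \<longleftrightarrow> C \<in> insert (?U \<union> ?V) (comps J W - {?U, ?V})"
      unfolding comps_def image_iff cls insert_iff Diff_iff empty_iff using assms(2) by metis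
  qed
  \<comment> \<open>The merged class is genuinely new: an old class other than \<open>?U\<close>
    would be disjoint from \<open>?U\<close>.\<close>
  moreover have "?U \<union> ?V \<notin> comps J W - {?U, ?V}"
  proof
    assume a: "?U \<union> ?V \<in> comps J W - {?U, ?V}"
    then have "(?U \<union> ?V) \<inter> ?U = {}" using comps_disjoint UV(2) by blast
    then show False using conn_refl[of u J] by blast
  qed
  moreover have "card (comps J W - {?U, ?V}) = card (comps J W) - 2"
    using UV by (subst card_Diff_subset) auto
  \<comment> \<open>This keeps the natural-number subtraction of 2 from truncating.\<close>
  moreover have "2 \<le> card (comps J W)"
    using card_mono[of "comps J W" "{?U, ?V}"] UV finite_comps[OF assms(1)] by auto
  ultimately show ?thesis
    using False finite_comps[OF assms(1)] by simp
qed

text \<open>Each vertex outside \<open>\<Union>J\<close> is a component of its own and raises both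
  counts by one. Ranks of different edge sets can therefore be computed over the same
  \<open>W\<close>.\<close>

lemma graphic_rank_superset:
  assumes "finite W" "\<Union>J \<subseteq> W"
  shows "graphic_rank J = int (card W) - int (card (comps J W))"
proof -
  have fin: "finite (\<Union>J)" using assms finite_subset by blast
  have out: "comps J (W - \<Union>J) = (\<lambda>x. {x}) ` (W - \<Union>J)"
    unfolding comps_def by (intro image_cong refl conn_outside) auto
  have "comps J W = comps J (\<Union>J) \<union> comps J (W - \<Union>J)"
    unfolding comps_def using assms(2) by blast
  moreover have "comps J (\<Union>J) \<inter> comps J (W - \<Union>J) = {}"
  proof -
    have "C \<subseteq> \<Union>J" if "C \<in> comps J (\<Union>J)" for C
      using that conn_within[of _ J] unfolding comps_def by blast
    then show ?thesis unfolding out by blast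
  qed
  ultimately have "card (comps J W) = card (comps J (\<Union>J)) + card (W - \<Union>J)"
    using assms fin by (simp add: card_Un_disjoint finite_comps out card_image)
  moreover have "card W = card (\<Union>J) + card (W - \<Union>J)"
    using assms fin by (simp add: card_Diff_subset card_mono)
  ultimately show ?thesis by (simp add: graphic_rank_def)
qed

text \<open>An edge raises the rank by 1 exactly when its ends are not yet connected. Ends connected
  in \<open>A\<close> stay connected in \<open>B\<close>, so the gain can only drop.\<close>

lemma graphic_rank_submodular:
  assumes "finite E" "\<And>e. e \<in> E \<Longrightarrow> card e = 2"
  shows "submodular_on E graphic_rank"
proof (rule submodular_on_diminishing_returns[OF assms(1)])
  fix A B e assume AB: "A \<subseteq> B" "B \<subseteq> E" and e: "e \<in> E"
  have finW: "finite (\<Union>E)"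
    using assms by (simp add: card_2_iff) fastforce
  obtain u v where uv: "e = {u, v}" using assms(2)[OF e] by (auto simp: card_2_iff)
  have gain: "graphic_rank (insert e X) - graphic_rank X = (if (u, v) \<in> conn X then 0 else 1)"
    if "X \<subseteq> E" for X
  proof -
    have "graphic_rank (insert e X) = int (card (\<Union>E)) - int (card (comps (insert e X) (\<Union>E)))"
      "graphic_rank X = int (card (\<Union>E)) - int (card (comps X (\<Union>E)))"
      using that e by (auto intro!: graphic_rank_superset[OF finW])
    moreover have "u \<in> \<Union>E" "v \<in> \<Union>E" using e uv by auto
    ultimately show ?thesis using card_comps_insert[OF finW, of u v X] uv by simp
  qed
  show "graphic_rank (insert e B) - graphic_rank B \<le> graphic_rank (insert e A) - graphic_rank A"
    using AB gain[of A] gain[of B] conn_mono[OF AB(1)] by auto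
qed

lemma graphic_rank_less:
  assumes "finite (\<Union>J)" "\<Union>J \<noteq> {}"
  shows "graphic_rank J \<le> int (card (\<Union>J)) - 1"
proof -
  have "comps J (\<Union>J) \<noteq> {}" using assms(2) by (auto simp: comps_def)
  then have "card (comps J (\<Union>J)) \<ge> 1"
    using finite_comps[OF assms(1)] by (simp add: Suc_le_eq card_gt_0_iff)
  then show ?thesis by (simp add: graphic_rank_def)
qed

section \<open>Sparse graphs\<close>

text \<open>Moves the real inequality to the integers, where all counting takes place.\<close>

lemma sparse_card_le:
  assumes "simple_graph G" "sparse (real_of_int a) (real_of_int b) G"
    and "F \<subseteq> edges G" "W \<subseteq> verts G" "W \<noteq> {}" "\<Union>F \<subseteq> W"
  shows "int (card F) \<le> a * int (card W) + b"
proof -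
  have "subgraph \<lparr>verts = W, edges = F\<rparr> G"
    using assms finite_subset[OF assms(4)] by (auto simp: subgraph_def simple_graph_def)
  then have "real (card F) \<le> real_of_int a * real (card W) + real_of_int b"
    using assms(2,5) unfolding sparse_def by (metis graph.select_convs)
  then have "real_of_int (int (card F)) \<le> real_of_int (a * int (card W) + b)" by simp
  then show ?thesis by linarith
qed

lemma sparse_card_le_components:
  assumes G: "simple_graph G" and sp: "sparse (real_of_int a) (real_of_int b) G"
    and J: "J \<subseteq> edges G"
  shows "int (card J) \<le> a * int (card (\<Union>J)) + b * int (card (comps J (\<Union>J)))"
proof -
  let ?Q = "comps J (\<Union>J)"
  have V: "\<Union>J \<subseteq> verts G" and fV: "finite (verts G)"
    using G J by (auto simp: simple_graph_def)
  then have fin: "finite (\<Union>J)" by (meson finite_subset)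
  have CJ: "C \<subseteq> \<Union>J" "C \<noteq> {}" if "C \<in> ?Q" for C
  proof -
    from that obtain x where x: "x \<in> \<Union>J" "C = conn J `` {x}" unfolding comps_def by blast
    show "C \<subseteq> \<Union>J" unfolding x(2) by (rule conn_within[OF x(1)])
    show "C \<noteq> {}" using x(2) conn_refl[of x J] by blast
  qed
  have cover: "\<Union>J = \<Union>?Q" 
  proof
    show "\<Union>J \<subseteq> \<Union>?Q" unfolding comps_def using conn_refl[of _ J] by blast
    show "\<Union>?Q \<subseteq> \<Union>J" using CJ(1) by blast
  qed
  \<comment> \<open>Both ends of an edge lie in the class of either end, so every edge is counted
    inside some class.\<close>
  have "J \<subseteq> (\<Union>C\<in>?Q. {e \<in> J. e \<subseteq> C})"
  proof
    fix e assume e: "e \<in> J"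
    then obtain u v where uv: "e = {u, v}"
      using G J by (meson card_2_iff simple_graph_def subsetD)
    then have "e \<subseteq> conn J `` {u}" using e conn_edge[of u v J] by auto
    moreover have "conn J `` {u} \<in> ?Q" using e uv by (auto simp: comps_def)
    ultimately show "e \<in> (\<Union>C\<in>?Q. {e \<in> J. e \<subseteq> C})" using e by blast
  qed
  moreover have "finite J" using fin finite_UnionD by blast
  ultimately have "card J \<le> card (\<Union>C\<in>?Q. {e \<in> J. e \<subseteq> C})"
    using finite_comps[OF fin] by (intro card_mono) auto
  also have "\<dots> \<le> (\<Sum>C\<in>?Q. card {e \<in> J. e \<subseteq> C})"
    by (rule card_UN_le[OF finite_comps[OF fin]])
  finally have "int (card J) \<le> (\<Sum>C\<in>?Q. int (card {e \<in> J. e \<subseteq> C}))"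
    by (metis of_nat_le_iff of_nat_sum)
  also have "\<dots> \<le> (\<Sum>C\<in>?Q. a * int (card C) + b)"
  proof (rule sum_mono)
    fix C assume "C \<in> ?Q"
    then show "int (card {e \<in> J. e \<subseteq> C}) \<le> a * int (card C) + b"
      using CJ[of C] V J by (intro sparse_card_le[OF G sp]) auto
  qed
  also have "\<dots> = a * int (\<Sum>C\<in>?Q. card C) + b * int (card ?Q)"
    by (simp add: sum.distrib sum_distrib_left)
  also have "(\<Sum>C\<in>?Q. card C) = card (\<Union>?Q)"
  proof (rule card_Union_disjoint[symmetric])
    show "pairwise disjnt ?Q"
      unfolding pairwise_def disjnt_def using comps_disjoint by blast
    show "finite C" if "C \<in> ?Q" for C
      using CJ(1)[OF that] fin by (rule finite_subset)
  qed
  finally show ?thesis using cover by simp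
qed

text \<open>Vertices of a subgraph beyond those spanned by its edges only enlarge the right-hand
  side, as \<open>0 \<le> a\<close>. An edgeless subgraph has at least one vertex, so
  \<open>- a \<le> b\<close> covers it.\<close>

lemma sparseI_Union:
  assumes "0 \<le> a" "- a \<le> b"
    and "\<And>J. J \<subseteq> edges G \<Longrightarrow> J \<noteq> {} \<Longrightarrow> int (card J) \<le> a * int (card (\<Union>J)) + b"
  shows "sparse (real_of_int a) (real_of_int b) G"
  unfolding sparse_def
proof (intro allI impI)
  fix H :: "'a graph" assume H: "subgraph H G \<and> verts H \<noteq> {}"
  then have fin: "finite (verts H)" and sub: "\<Union>(edges H) \<subseteq> verts H" and eG: "edges H \<subseteq> edges G"
    by (auto simp: subgraph_def simple_graph_def)
  have "int (card (edges H)) \<le> a * int (card (verts H)) + b"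
  proof (cases "edges H = {}")
    case True
    have "card (verts H) \<ge> 1" using H fin by (simp add: Suc_le_eq card_gt_0_iff)
    then have "a * 1 \<le> a * int (card (verts H))" using assms(1) by (intro mult_left_mono) auto
    then show ?thesis using True assms(2) by simp
  next
    case False
    have "a * int (card (\<Union>(edges H))) \<le> a * int (card (verts H))"
      using assms(1) card_mono[OF fin sub] by (intro mult_left_mono) auto
    then show ?thesis using assms(3)[OF eG False] by linarith
  qed
  then have "real_of_int (int (card (edges H))) \<le> real_of_int (a * int (card (verts H)) + b)"
    by linarith
  then show "real (card (edges H)) \<le> real_of_int a * real (card (verts H)) + real_of_int b"
    by simp
qed

text \<open>The common end of both cases. Each class is taken as a spanning subgraph of
  \<open>G\<close>; \<open>le1\<close> and \<open>le2\<close> turn the bounds by \<open>r1\<close>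
  and \<open>r2\<close> into sparsity.\<close>

lemma sparse_partition_of_submodular:
  fixes G :: "'v graph"
  assumes a: "0 \<le> a1" "- a1 \<le> b1" "0 \<le> a2" "- a2 \<le> b2" and G: "simple_graph G"
    and r: "submodular_on (edges G) r1" "submodular_on (edges G) r2" "r1 {} = 0" "r2 {} = 0"
    and bound: "\<And>J. J \<subseteq> edges G \<Longrightarrow> int (card J) \<le> r1 J + r2 J"
    and le1: "\<And>J. J \<subseteq> edges G \<Longrightarrow> J \<noteq> {} \<Longrightarrow> r1 J \<le> a1 * int (card (\<Union>J)) + b1"
    and le2: "\<And>J. J \<subseteq> edges G \<Longrightarrow> J \<noteq> {} \<Longrightarrow> r2 J \<le> a2 * int (card (\<Union>J)) + b2"
  shows "\<exists>G1 G2. subgraph G1 G \<and> subgraph G2 G \<and>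
           edges G = edges G1 \<union> edges G2 \<and> edges G1 \<inter> edges G2 = {} \<and>
           sparse (real_of_int a1) (real_of_int b1) G1 \<and>
           sparse (real_of_int a2) (real_of_int b2) G2"
proof -
  have "finite (edges G)"
    using G by (auto simp: simple_graph_def intro: finite_subset[of _ "Pow (verts G)"])
  then obtain F1 F2 where F: "F1 \<union> F2 = edges G" "F1 \<inter> F2 = {}"
    and F1: "\<And>J. J \<subseteq> F1 \<Longrightarrow> int (card J) \<le> r1 J" and F2: "\<And>J. J \<subseteq> F2 \<Longrightarrow> int (card J) \<le> r2 J"
    using submodular_partition[OF _ r bound] by metis
  let ?G1 = "\<lparr>verts = verts G, edges = F1\<rparr>" and ?G2 = "\<lparr>verts = verts G, edges = F2\<rparr>"
  have "sparse (real_of_int a1) (real_of_int b1) ?G1"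
  proof (rule sparseI_Union[OF a(1,2)])
    fix J assume "J \<subseteq> edges ?G1" "J \<noteq> {}"
    then show "int (card J) \<le> a1 * int (card (\<Union>J)) + b1"
      using F1[of J] le1[of J] F(1) by force
  qed
  moreover have "sparse (real_of_int a2) (real_of_int b2) ?G2"
  proof (rule sparseI_Union[OF a(3,4)])
    fix J assume "J \<subseteq> edges ?G2" "J \<noteq> {}"
    then show "int (card J) \<le> a2 * int (card (\<Union>J)) + b2"
      using F2[of J] le2[of J] F(1) by force
  qed
  moreover have "subgraph ?G1 G" "subgraph ?G2 G"
    using G F(1) by (auto simp: subgraph_def simple_graph_def)
  ultimately show ?thesis using F
    by (intro exI[of _ ?G1] exI[of _ ?G2]) simp
qed

text \<open>The value at the empty set is fixed at 0 for use in the partition lemma. For disjoint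
  nonempty \<open>A\<close> and \<open>B\<close> the left side has the offset \<open>b\<close> once
  and the right side twice, hence \<open>0 \<le> b\<close>.\<close>

lemma submodular_vertex_count_offset:
  assumes "finite (\<Union>E)" "0 \<le> a" "0 \<le> b"
  shows "submodular_on E (\<lambda>J. if J = {} then 0 else a * int (card (\<Union>J)) + b)"
  unfolding submodular_on_def
proof (intro allI impI)
  fix A B assume AB: "A \<subseteq> E" "B \<subseteq> E"
  have "a * int (card (\<Union>(A \<union> B))) + a * int (card (\<Union>(A \<inter> B)))
      \<le> a * int (card (\<Union>A)) + a * int (card (\<Union>B))"
    using submodular_onD[OF submodular_on_scale[OF card_Union_submodular[OF assms(1)] assms(2)] AB] .
  then show "(if A \<union> B = {} then 0 else a * int (card (\<Union>(A \<union> B))) + b) +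
        (if A \<inter> B = {} then 0 else a * int (card (\<Union>(A \<inter> B))) + b)
      \<le> (if A = {} then 0 else a * int (card (\<Union>A)) + b) + (if B = {} then 0 else a * int (card (\<Union>B)) + b)"
    using assms(3) by auto
qed

theorem theorem1:
  fixes a1 a2 b1 b2 :: int and G :: "'v graph"
  assumes "a1 > 0" and "a2 > 0"
    and "(- a1 \<le> b1 \<and> b1 \<le> 0 \<and> - a2 \<le> b2 \<and> b2 \<le> 0) \<or> (b1 \<ge> 0 \<and> b2 \<ge> 0)"
    and "simple_graph G"
    and "sparse (real_of_int (a1 + a2)) (real_of_int (b1 + b2)) G"
  shows "\<exists>G1 G2. subgraph G1 G \<and> subgraph G2 G \<and>
           edges G = edges G1 \<union> edges G2 \<and> edges G1 \<inter> edges G2 = {} \<and>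
           sparse (real_of_int a1) (real_of_int b1) G1 \<and>
           sparse (real_of_int a2) (real_of_int b2) G2"
proof -
  note G = assms(4) and sp = assms(5)
  have V: "\<Union>(edges G) \<subseteq> verts G" "finite (verts G)"
    and two: "\<And>e. e \<in> edges G \<Longrightarrow> card e = 2"
    using G by (auto simp: simple_graph_def)
  then have fV: "finite (\<Union>(edges G))" by (meson finite_subset)
  then have fE: "finite (edges G)" by (rule finite_UnionD)
  have UJ: "\<Union>J \<subseteq> verts G" "finite (\<Union>J)" if "J \<subseteq> edges G" for J
    using that V(1) fV by (meson Union_mono finite_subset subset_trans)+
  have ne: "\<Union>J \<noteq> {}" if J: "J \<subseteq> edges G" "J \<noteq> {}" for J
  proof -
    obtain e where "e \<in> J" using J(2) by blast
    moreover from this have "e \<noteq> {}" using two J(1) by fastforce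
    ultimately show ?thesis by blast
  qed
  from assms(3) show ?thesis
  proof
    assume A: "- a1 \<le> b1 \<and> b1 \<le> 0 \<and> - a2 \<le> b2 \<and> b2 \<le> 0"
    let ?r = "\<lambda>a b J. (a + b) * int (card (\<Union>J)) + (- b) * graphic_rank J"
    \<comment> \<open>The two inequalities say exactly that the coefficients \<open>a + b\<close>
      and \<open>- b\<close> are nonnegative.\<close>
    have sub: "submodular_on (edges G) (?r a b)" if "- a \<le> b" "b \<le> 0" for a b
      using that by (intro submodular_on_add submodular_on_scale
          card_Union_submodular[OF fV] graphic_rank_submodular[OF fE two]) auto
    have le: "?r a b J \<le> a * int (card (\<Union>J)) + b" if "b \<le> 0" "J \<subseteq> edges G" "J \<noteq> {}" for a b J
    proof -
      \<comment> \<open>A nonempty \<open>J\<close> has at least one component, so for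
        \<open>b \<le> 0\<close> the component term is at most \<open>b\<close>.\<close>
      have "(- b) * graphic_rank J \<le> (- b) * (int (card (\<Union>J)) - 1)"
        using that graphic_rank_less[OF UJ(2) ne] by (intro mult_left_mono) auto
      then show ?thesis by (simp add: algebra_simps)
    qed
    have empty: "?r a b {} = 0" for a b by (simp add: graphic_rank_def comps_def)
    have bound: "int (card J) \<le> ?r a1 b1 J + ?r a2 b2 J" if "J \<subseteq> edges G" for J
      using sparse_card_le_components[OF G sp that]
      by (simp add: graphic_rank_def algebra_simps)
    show ?thesis
      using A assms(1,2) G
      by (intro sparse_partition_of_submodular[where ?r1.0 = "?r a1 b1" and ?r2.0 = "?r a2 b2"]
          sub le empty bound) auto
  next
    assume B: "b1 \<ge> 0 \<and> b2 \<ge> 0"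
    let ?r = "\<lambda>a b J. if J = {} then 0 else a * int (card (\<Union>J)) + b"
    \<comment> \<open>For nonempty \<open>J\<close> the right side is the sparsity bound of
      \<open>G\<close> for the subgraph with vertex set \<open>\<Union>J\<close>.\<close>
    have bound: "int (card J) \<le> ?r a1 b1 J + ?r a2 b2 J" if "J \<subseteq> edges G" for J
    proof (cases "J = {}")
      case False
      show ?thesis
        using sparse_card_le[OF G sp that UJ(1)[OF that] ne[OF that False]] False
        by (simp add: algebra_simps)
    qed simp
    show ?thesis
      using B assms(1,2) G
      by (intro sparse_partition_of_submodular[where ?r1.0 = "?r a1 b1" and ?r2.0 = "?r a2 b2"]
          submodular_vertex_count_offset[OF fV] bound) auto
  qed
qed

end
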